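(* Let $\{\varphi_r\}_{0<r<1}$ be an arbitrary approximate identity, and suppose that for some $1\le p<\infty$ the function $\lambda:(0,1)\to(0,\infty)$, with $\lim_{r\to1}\lambda(r)=0$, satisfies $$\tilde\Pi_p(\lambda,\varphi)=\sup_{0<r<1}\lambda(r)\,\|\varphi_r\|_\infty\,\varphi_*(r)^{p-1}<\infty .$$ Then for any $f\in L^p(\mathbb T)$ $$\Phi_\lambda^*(x,f)\le C\left(M|f|^p(x)\right)^{1/p},\qquad x\in\mathbb T,$$ where the constant $C$ does not depend on $f$. In particular, the operator $\Phi_\lambda^*$ is of weak type $(p,p)$, i.e. $$\left|\{x\in\mathbb T:\ \Phi_\lambda^*(x,f)>t\}\right|\le\frac{\tilde C}{t^p}\|f\|_p^p$$ holds for any $t>0$, where the constant $\tilde C$ does not depend on $f$ and $t$.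
   Context: $\mathbb T=\mathbb R/2\pi\mathbb Z$; points are represented by $t$ with $|t|\le\pi$, and functions on $\mathbb T$ are regarded as $2\pi$-periodic. An approximate identity is a family $\{\varphi_r\}_{0<r<1}\subset L^\infty(\mathbb T)$ such that: ($\Phi1$) $\int_{\mathbb T}\varphi_r(t)\,dt\to1$ as $r\to1$; ($\Phi2$) $\varphi_r^*(x):=\sup_{|x|\le|t|\le\pi}|\varphi_r(t)|\to0$ as $r\to1$ for each $0<|x|\le\pi$; ($\Phi3$) $C_\varphi:=\sup_{0<r<1}\|\varphi_r^*\|_1<\infty$. $\varphi_*(r):=\sup_{x\in\mathbb T}|x\,\varphi_r^*(x)|$ (with $|x|\le\pi$). The maximal operator is $$\Phi_\lambda^*(x,f):=\sup_{\substack{|x-y|<\lambda(r)\\ 0<r<1}}\left|\int_{\mathbb T}\varphi_r(y-t)f(t)\,dt\right| .$$ $Mg(x):=\sup_{t>0}\frac1{2t}\int_{x-t}^{x+t}|g(u)|\,du$ is the Hardy--Littlewood maximal function, and $M|f|^p$ denotes $M(|f|^p)$. *)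

theory Defs
  imports "HOL-Analysis.Analysis" "HOL-Probability.Essential_Supremum"
begin

text \<open>
  Functions on the circle \<open>\<real>/2\<pi>\<int>\<close> are \<open>2\<pi>\<close>-periodic functions on \<open>real\<close>; integrals over the
  circle are (unnormalised) Lebesgue integrals over \<open>[-\<pi>, \<pi>]\<close>.  Scalars are complex, which covers
  the real-valued case.  Quantities that may a priori be infinite live in \<open>ennreal\<close>.
\<close>

definition periodic_2pi :: "(real \<Rightarrow> complex) \<Rightarrow> bool" where
  "periodic_2pi f \<longleftrightarrow> (\<forall>x. f (x + 2 * pi) = f x)"

definition Lp_circle :: "real \<Rightarrow> (real \<Rightarrow> complex) set" where
  "Lp_circle p = {f. f \<in> borel_measurable lebesgue \<and> periodic_2pi f \<and>
     set_integrable lebesgue {-pi..pi} (\<lambda>t. cmod (f t) powr p)}"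

definition Lp_norm :: "real \<Rightarrow> (real \<Rightarrow> complex) \<Rightarrow> real" where
  "Lp_norm p f = (LINT t:{-pi..pi}|lebesgue. cmod (f t) powr p) powr (1 / p)"

definition Linf_norm :: "(real \<Rightarrow> complex) \<Rightarrow> ennreal" where
  "Linf_norm g = esssup (restrict_space lebesgue {-pi..pi}) (\<lambda>t. ennreal (cmod (g t)))"

definition Linf_circle :: "(real \<Rightarrow> complex) set" where
  "Linf_circle = {g. g \<in> borel_measurable lebesgue \<and> periodic_2pi g \<and> Linf_norm g < top}"

text \<open>
  The majorant \<open>\<phi>\<^sub>r\<^sup>*\<close>.  Elements of \<open>L\<^sup>\<infinity>\<close> are defined only almost everywhere, so the
  supremum is an essential one.  At \<open>\<bar>x\<bar> = \<pi>\<close> it ranges over a null set and is \<open>0\<close>.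
\<close>

definition majorant :: "(real \<Rightarrow> complex) \<Rightarrow> real \<Rightarrow> ennreal" where
  "majorant g x = esssup (restrict_space lebesgue {t. \<bar>x\<bar> \<le> \<bar>t\<bar> \<and> \<bar>t\<bar> \<le> pi})
                         (\<lambda>t. ennreal (cmod (g t)))"

definition approximate_identity :: "(real \<Rightarrow> real \<Rightarrow> complex) \<Rightarrow> bool" where
  "approximate_identity \<phi> \<longleftrightarrow>
     (\<forall>r\<in>{0<..<1}. \<phi> r \<in> Linf_circle) \<and>
     ((\<lambda>r. LINT t:{-pi..pi}|lebesgue. \<phi> r t) \<longlongrightarrow> 1) (at_left 1) \<and>
     (\<forall>x. 0 < \<bar>x\<bar> \<and> \<bar>x\<bar> \<le> pi \<longrightarrow> ((\<lambda>r. majorant (\<phi> r) x) \<longlongrightarrow> 0) (at_left 1)) \<and>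
     (SUP r\<in>{0<..<1}. \<integral>\<^sup>+ x\<in>{-pi..pi}. majorant (\<phi> r) x \<partial>lebesgue) < top"

definition weighted_sup :: "(real \<Rightarrow> complex) \<Rightarrow> ennreal" where
  "weighted_sup g = (SUP x\<in>{-pi..pi}. ennreal \<bar>x\<bar> * majorant g x)"

text \<open>
  Powers of extended nonnegative reals with real exponent \<open>p \<ge> 0\<close>.  Unlike \<open>powr\<close> on the
  reals, this has \<open>0\<^sup>0 = 1\<close>, as needed for the exponent \<open>p - 1\<close> with \<open>p = 1\<close>.
\<close>

definition ennreal_power :: "ennreal \<Rightarrow> real \<Rightarrow> ennreal" where
  "ennreal_power a p =
     (if p = 0 then 1 else if a = top then top else ennreal (enn2real a powr p))"

definition Pi_tilde :: "real \<Rightarrow> (real \<Rightarrow> real) \<Rightarrow> (real \<Rightarrow> real \<Rightarrow> complex) \<Rightarrow> ennreal" where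
  "Pi_tilde p lam \<phi> =
     (SUP r\<in>{0<..<1}. ennreal (lam r) * Linf_norm (\<phi> r) * ennreal_power (weighted_sup (\<phi> r)) (p - 1))"

text \<open>
  Since the convolution is \<open>2\<pi>\<close>-periodic in \<open>y\<close>, letting \<open>y\<close> range over all reals with
  \<open>\<bar>x - y\<bar> < \<lambda>(r)\<close> amounts to using the distance of the circle.
\<close>

definition Phi_star ::
    "(real \<Rightarrow> real) \<Rightarrow> (real \<Rightarrow> real \<Rightarrow> complex) \<Rightarrow> real \<Rightarrow> (real \<Rightarrow> complex) \<Rightarrow> ennreal" where
  "Phi_star lam \<phi> x f =
     (SUP r\<in>{0<..<1}. SUP y\<in>{y. \<bar>x - y\<bar> < lam r}.
        ennreal (cmod (LINT t:{-pi..pi}|lebesgue. \<phi> r (y - t) * f t)))"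

definition HL_maximal :: "(real \<Rightarrow> real) \<Rightarrow> real \<Rightarrow> ennreal" where
  "HL_maximal g x =
     (SUP t\<in>{0<..}. (\<integral>\<^sup>+ u\<in>{x - t..x + t}. ennreal \<bar>g u\<bar> \<partial>lebesgue) / ennreal (2 * t))"

end

theory Submission
  imports Defs
begin

text \<open>
  Write \<open>F = \<bar>f\<bar>\<close>, and for a fixed \<open>r\<close> let \<open>A = \<parallel>\<phi>\<^sub>r\<parallel>\<^sub>\<infinity> > 0\<close>, \<open>B = sup \<bar>t\<bar> \<phi>\<^sub>r\<^sup>*(t)\<close> and \<open>l = \<lambda>(r)\<close>.  A substitution
  bounds the convolution at \<open>y\<close> by the integral of \<open>\<bar>\<phi>\<^sub>r(t)\<bar> F(y - t)\<close> over \<open>\<bar>t\<bar> \<le> \<pi>\<close>, so only averages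
  \<open>N(s)\<close> of \<open>F\<close> over \<open>[y - s, y + s]\<close> matter.  When \<open>\<bar>x - y\<bar> < l\<close>, that interval lies in the interval of
  radius \<open>s + l\<close> about \<open>x\<close>, and Hoelder's inequality gives
  \<open>N(s) \<le> 4 (s + s\<^bsup>1 - 1/p\<^esup> l\<^bsup>1/p\<^esup>) (M F\<^sup>p(x))\<^bsup>1/p\<^esup>\<close>
  (lemma \<open>nearby_average_le_HL_maximal\<close>).

  Almost everywhere the kernel is at most \<open>A\<close> for \<open>\<bar>t\<bar> \<le> \<delta>\<close> and at most \<open>\<phi>\<^sub>r\<^sup>*(2\<^sup>n \<delta>)\<close> on the dyadic shell
  \<open>2\<^sup>n \<delta> \<le> \<bar>t\<bar> \<le> 2\<^bsup>n+1\<^esup> \<delta>\<close>, for any \<open>\<delta> > 0\<close> (lemma \<open>dyadic_kernel_bound\<close>).  The summand \<open>s\<close> in the bound for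
  \<open>N(s)\<close> contributes \<open>A \<delta> + \<Sum>\<^sub>n 2\<^sup>n \<delta> \<phi>\<^sub>r\<^sup>*(2\<^sup>n \<delta>)\<close> up to a constant, and this series is twice a lower Riemann sum for
  the integral of the decreasing function \<open>\<phi>\<^sub>r\<^sup>*\<close>.  The summand with \<open>l\<close> contributes, by
  \<open>\<phi>\<^sub>r\<^sup>*(t) \<le> B / \<bar>t\<bar>\<close>, a multiple of
  \<open>l\<^bsup>1/p\<^esup> (A \<delta>\<^bsup>1 - 1/p\<^esup> + B \<delta>\<^bsup>-1/p\<^esup> \<Sum>\<^sub>n 2\<^bsup>-n/p\<^esup>)\<close>.  The choice \<open>\<delta> = B / A\<close> balances the two terms: both become
  \<open>(l A B\<^bsup>p-1\<^esup>)\<^bsup>1/p\<^esup>\<close>, which is what \<open>Pi_tilde\<close> bounds, while \<open>A \<delta> = B\<close> is at most the integral of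
  \<open>\<phi>\<^sub>r\<^sup>*\<close>.  Since the geometric series has ratio \<open>2\<^bsup>-1/p\<^esup>\<close>, the argument works for \<open>p = 1\<close> as it stands.

  The weak-type statement follows from the pointwise one and the weak \<open>(1,1)\<close> inequality for the maximal
  function of the periodic function \<open>F\<^sup>p\<close>, which is proved by Vitali's covering lemma.  The superlevel sets
  of \<open>Phi_star\<close> are unions of open intervals, hence measurable.
\<close>

section \<open>Integration on the circle\<close>

lemma measurable_lebesgue_reflect [measurable]:
  fixes y :: real shows "(\<lambda>t. y - t) \<in> lebesgue \<rightarrow>\<^sub>M lebesgue"
  using lebesgue_affine_measurable[where c="\<lambda>_::real. -1" and t=y] by simp

lemma nn_integral_lebesgue_reflect:
  fixes F :: "real \<Rightarrow> ennreal"
  assumes "F \<in> borel_measurable lebesgue"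
  shows "(\<integral>\<^sup>+t. F (y - t) \<partial>lebesgue) = (\<integral>\<^sup>+t. F t \<partial>lebesgue)"
  using nn_integral_real_affine_lebesgue[OF assms, of "-1" y] by simp

lemma nn_integral_lebesgue_shift:
  fixes F :: "real \<Rightarrow> ennreal"
  assumes "F \<in> borel_measurable lebesgue"
  shows "(\<integral>\<^sup>+t. F (t + y) \<partial>lebesgue) = (\<integral>\<^sup>+t. F t \<partial>lebesgue)"
  using nn_integral_real_affine_lebesgue[OF assms, of 1 y] by (simp add: add.commute)

lemma set_nn_integral_reflect:
  fixes F :: "real \<Rightarrow> ennreal"
  assumes [measurable]: "F \<in> borel_measurable lebesgue"
  shows "(\<integral>\<^sup>+t\<in>{a..b}. F (y - t) \<partial>lebesgue) = (\<integral>\<^sup>+t\<in>{y-b..y-a}. F t \<partial>lebesgue)"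
proof -
  have "(\<lambda>t. F t * indicator {y-b..y-a} t) \<in> borel_measurable lebesgue"
    by (intro borel_measurable_times_ennreal assms borel_measurable_indicator) simp
  from nn_integral_lebesgue_reflect[OF this, of y] show ?thesis
    by (auto simp: indicator_def intro!: nn_integral_cong elim!: trans[rotated])
qed

lemma set_nn_integral_shift:
  fixes F :: "real \<Rightarrow> ennreal"
  assumes F: "F \<in> borel_measurable lebesgue" and "S \<in> sets lebesgue"
  shows "(\<integral>\<^sup>+t\<in>{t. t + y \<in> S}. F (t + y) \<partial>lebesgue) = (\<integral>\<^sup>+t\<in>S. F t \<partial>lebesgue)"
proof -
  have "(\<lambda>t. F t * indicator S t) \<in> borel_measurable lebesgue"
    by (intro borel_measurable_times_ennreal assms borel_measurable_indicator)
  from nn_integral_lebesgue_shift[OF this, of y] show ?thesis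
    by (auto simp: indicator_def intro!: nn_integral_cong elim!: trans[rotated])
qed

lemma periodic_int:
  assumes "\<And>t::real. F (t + 2 * pi) = F t"
  shows "F (t + 2 * pi * of_int k) = F t"
proof (induction k rule: int_induct[where k=0])
  case (step1 i)
  then show ?case using assms[of "t + 2 * pi * of_int i"] by (simp add: algebra_simps)
next
  case (step2 i)
  then show ?case using assms[of "t + 2 * pi * of_int (i - 1)"] by (simp add: algebra_simps)
qed simp

text \<open>
  Subtracting a multiple of the period moves \<open>a\<close> to a point \<open>c\<close> of \<open>[-\<pi>, \<pi>)\<close>; the part of \<open>[c, c + 2\<pi>]\<close> that
  lies beyond \<open>\<pi>\<close> is then the translate of \<open>[-\<pi>, c]\<close>, the part of \<open>[-\<pi>, \<pi>]\<close> that is missing.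
\<close>

lemma set_nn_integral_periodic:
  fixes F :: "real \<Rightarrow> ennreal"
  assumes F: "F \<in> borel_measurable lebesgue" and per: "\<And>t. F (t + 2 * pi) = F t"
  shows "(\<integral>\<^sup>+t\<in>{a..a+2*pi}. F t \<partial>lebesgue) = (\<integral>\<^sup>+t\<in>{-pi..pi}. F t \<partial>lebesgue)"
proof -
  define k where "k = \<lfloor>(a + pi) / (2 * pi)\<rfloor>"
  define c where "c = a - 2 * pi * k"
  have "k \<le> (a + pi) / (2 * pi)" "(a + pi) / (2 * pi) < k + 1" unfolding k_def by linarith+
  then have c: "-pi \<le> c" "c < pi"
    by (auto simp: c_def field_simps)
  have "(\<integral>\<^sup>+t\<in>{a..a+2*pi}. F t \<partial>lebesgue) = (\<integral>\<^sup>+t\<in>{c..c+2*pi}. F t \<partial>lebesgue)"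
    using set_nn_integral_shift[OF F, of "{a..a+2*pi}" "2 * pi * k"] periodic_int[of F, OF per]
    by (simp add: c_def algebra_simps atLeastAtMost_def atLeast_def atMost_def Int_def)
  also have "\<dots> = (\<integral>\<^sup>+t\<in>{c..<pi} \<union> {pi..c+2*pi}. F t \<partial>lebesgue)"
    using c by (intro arg_cong[where f="\<lambda>S. set_nn_integral lebesgue S F"]) auto
  also have "\<dots> = (\<integral>\<^sup>+t\<in>{c..<pi}. F t \<partial>lebesgue) + (\<integral>\<^sup>+t\<in>{pi..c+2*pi}. F t \<partial>lebesgue)"
    using F by (intro nn_integral_disjoint_pair) auto
  also have "(\<integral>\<^sup>+t\<in>{pi..c+2*pi}. F t \<partial>lebesgue) = (\<integral>\<^sup>+t\<in>{-pi..c}. F t \<partial>lebesgue)"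
  proof -
    have "{t. t + 2 * pi \<in> {pi..c+2*pi}} = {-pi..c}" by auto
    then show ?thesis using set_nn_integral_shift[OF F, of "{pi..c+2*pi}" "2 * pi"] per by simp
  qed
  also have "\<dots> = (\<integral>\<^sup>+t\<in>{-pi..<c}. F t \<partial>lebesgue)"
  proof (intro nn_integral_cong_AE)
    have "AE t in lebesgue. t \<noteq> c" by (intro AE_completion AE_lborel_singleton)
    then show "AE t in lebesgue. F t * indicator {-pi..c} t = F t * indicator {-pi..<c} t"
      by eventually_elim (auto simp: indicator_def)
  qed
  also have "(\<integral>\<^sup>+t\<in>{c..<pi}. F t \<partial>lebesgue) + \<dots> = (\<integral>\<^sup>+t\<in>{c..<pi} \<union> {-pi..<c}. F t \<partial>lebesgue)"
    using F by (intro nn_integral_disjoint_pair[symmetric]) auto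
  also have "\<dots> = (\<integral>\<^sup>+t\<in>{-pi..pi}. F t \<partial>lebesgue)"
  proof (intro nn_integral_cong_AE)
    have "AE t in lebesgue. t \<noteq> pi" by (intro AE_completion AE_lborel_singleton)
    then show "AE t in lebesgue. F t * indicator ({c..<pi} \<union> {-pi..<c}) t = F t * indicator {-pi..pi} t"
      by eventually_elim (use c in \<open>auto simp: indicator_def\<close>)
  qed
  finally show ?thesis .
qed

lemma periodic_convolution_nn_integral:
  fixes g F :: "real \<Rightarrow> ennreal"
  assumes g: "g \<in> borel_measurable lebesgue" and F: "F \<in> borel_measurable lebesgue"
    and per: "\<And>t. g (t + 2 * pi) = g t" "\<And>t. F (t + 2 * pi) = F t"
  shows "(\<integral>\<^sup>+t\<in>{-pi..pi}. g (y - t) * F t \<partial>lebesgue) = (\<integral>\<^sup>+t\<in>{-pi..pi}. g t * F (y - t) \<partial>lebesgue)"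
proof -
  have m: "(\<lambda>t. g t * F (y - t)) \<in> borel_measurable lebesgue"
    using g measurable_compose[OF measurable_lebesgue_reflect F]
    by (intro borel_measurable_times_ennreal) auto
  have p: "g (t + 2 * pi) * F (y - (t + 2 * pi)) = g t * F (y - t)" for t
    using per(1)[of t] per(2)[of "y - (t + 2 * pi)"] by (simp add: algebra_simps)
  show ?thesis
    using set_nn_integral_reflect[OF m, where a="-pi" and b=pi and y=y]
      set_nn_integral_periodic[OF m p, where a="y - pi"]
    by (simp add: add.commute)
qed

section \<open>The radial majorant\<close>

lemma AE_le_majorant:
  assumes "g \<in> borel_measurable lebesgue"
  shows "AE t in lebesgue. \<bar>x\<bar> \<le> \<bar>t\<bar> \<and> \<bar>t\<bar> \<le> pi \<longrightarrow> ennreal (cmod (g t)) \<le> majorant g x"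
proof -
  let ?S = "{t::real. \<bar>x\<bar> \<le> \<bar>t\<bar> \<and> \<bar>t\<bar> \<le> pi}"
  have "?S \<in> sets borel" by measurable
  then have "?S \<in> sets lebesgue" by simp
  with esssup_AE[of "\<lambda>t. ennreal (cmod (g t))" "restrict_space lebesgue ?S"]
  show ?thesis
    by (subst (asm) AE_restrict_space_iff) (auto simp: majorant_def)
qed

lemma majorant_leI_AE:
  assumes "g \<in> borel_measurable lebesgue"
    and "AE t in lebesgue. \<bar>x\<bar> \<le> \<bar>t\<bar> \<and> \<bar>t\<bar> \<le> pi \<longrightarrow> ennreal (cmod (g t)) \<le> c"
  shows "majorant g x \<le> c"
  unfolding majorant_def
proof (rule esssup_I)
  let ?S = "{t::real. \<bar>x\<bar> \<le> \<bar>t\<bar> \<and> \<bar>t\<bar> \<le> pi}"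
  have "?S \<in> sets borel" by measurable
  then have "?S \<in> sets lebesgue" by simp
  with assms(2) show "AE t in restrict_space lebesgue ?S. ennreal (cmod (g t)) \<le> c"
    by (subst AE_restrict_space_iff) auto
  show "(\<lambda>t. ennreal (cmod (g t))) \<in> borel_measurable (restrict_space lebesgue ?S)"
    using assms(1) by (intro measurable_restrict_space1) simp
qed

lemma majorant_mono:
  assumes "g \<in> borel_measurable lebesgue" "\<bar>x\<bar> \<le> \<bar>x'\<bar>"
  shows "majorant g x' \<le> majorant g x"
  using AE_le_majorant[OF assms(1), of x] assms
  by (intro majorant_leI_AE) (auto elim!: eventually_mono)

lemma majorant_eq_0:
  assumes "g \<in> borel_measurable lebesgue" "pi < \<bar>x\<bar>"
  shows "majorant g x = 0"
  using majorant_leI_AE[OF assms(1), of x 0] assms(2) by force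

lemma Linf_norm_eq_majorant: "Linf_norm g = majorant g 0"
proof -
  have "{t. \<bar>0::real\<bar> \<le> \<bar>t\<bar> \<and> \<bar>t\<bar> \<le> pi} = {-pi..pi}" by auto
  then show ?thesis by (simp only: Linf_norm_def majorant_def)
qed

lemma weighted_sup_upper:
  assumes "g \<in> borel_measurable lebesgue" "0 \<le> x"
  shows "ennreal x * majorant g x \<le> weighted_sup g"
proof (cases "x \<le> pi")
  case True
  with assms show ?thesis unfolding weighted_sup_def by (intro SUP_upper2[of x]) auto
qed (use majorant_eq_0[OF assms(1), of x] assms in auto)

text \<open>
  By monotonicity \<open>\<phi>\<^sup>*(x) \<le> \<phi>\<^sup>*(t)\<close> for all \<open>t\<close> between \<open>0\<close> and \<open>\<bar>x\<bar>\<close>, so \<open>\<bar>x\<bar> \<phi>\<^sup>*(x)\<close> is the area of a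
  rectangle below the graph of \<open>\<phi>\<^sup>*\<close>.
\<close>

lemma weighted_sup_le_integral:
  assumes g: "g \<in> borel_measurable lebesgue"
  shows "weighted_sup g \<le> (\<integral>\<^sup>+x\<in>{-pi..pi}. majorant g x \<partial>lebesgue)"
  unfolding weighted_sup_def
proof (rule SUP_least)
  fix x assume x: "x \<in> {-pi..pi}"
  have "ennreal \<bar>x\<bar> * majorant g x = (\<integral>\<^sup>+t. majorant g x * indicator {0..\<bar>x\<bar>} t \<partial>lebesgue)"
    by (subst nn_integral_cmult_indicator) (auto simp: mult.commute)
  also have "\<dots> \<le> (\<integral>\<^sup>+x\<in>{-pi..pi}. majorant g x \<partial>lebesgue)"
    using x by (intro nn_integral_mono) (auto simp: indicator_def intro!: majorant_mono[OF g])
  finally show "ennreal \<bar>x\<bar> * majorant g x \<le> (\<integral>\<^sup>+x\<in>{-pi..pi}. majorant g x \<partial>lebesgue)" .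
qed

text \<open>
  This makes the radius \<open>\<delta> = B / A\<close> positive.  If the weighted supremum vanishes, then \<open>\<phi>\<^sup>*\<close> vanishes away from
  the origin, and the kernel is zero almost everywhere outside each interval \<open>\<bar>t\<bar> < 1/n\<close>.
\<close>

lemma weighted_sup_pos:
  assumes g: "g \<in> borel_measurable lebesgue" and pos: "0 < Linf_norm g"
  shows "0 < weighted_sup g"
proof (rule ccontr)
  assume "\<not> ?thesis"
  then have B: "weighted_sup g = 0" by simp
  have z: "majorant g (1 / Suc n) = 0" for n
    using weighted_sup_upper[OF g, of "1 / Suc n"] by (simp add: B)
  have "AE t in lebesgue. \<forall>n. \<bar>1 / Suc n\<bar> \<le> \<bar>t\<bar> \<and> \<bar>t\<bar> \<le> pi \<longrightarrow> ennreal (cmod (g t)) \<le> majorant g (1 / Suc n)"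
    by (subst AE_all_countable) (intro allI AE_le_majorant[OF g])
  moreover have "AE t in lebesgue. t \<noteq> (0::real)" by (intro AE_completion AE_lborel_singleton)
  ultimately have "AE t in lebesgue. \<bar>0\<bar> \<le> \<bar>t\<bar> \<and> \<bar>t\<bar> \<le> pi \<longrightarrow> ennreal (cmod (g t)) \<le> 0"
  proof eventually_elim
    case (elim t)
    then obtain n where "inverse (real (Suc n)) < \<bar>t\<bar>" using reals_Archimedean[of "\<bar>t\<bar>"] by auto
    then show ?case using elim(1)[rule_format, of n] z[of n] by (auto simp: inverse_eq_divide)
  qed
  then have "majorant g 0 \<le> 0" by (rule majorant_leI_AE[OF g])
  with pos show False by (simp add: Linf_norm_eq_majorant)
qed

text \<open>
  Half of each summand is the area of the rectangle of height \<open>\<phi>\<^sup>*(2\<^sup>n d)\<close> over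
  \<open>(2\<^bsup>n-1\<^esup> d, 2\<^sup>n d]\<close>.  These intervals are disjoint, and since \<open>\<phi>\<^sup>*\<close> decreases, the rectangles lie below
  its graph.
\<close>

lemma dyadic_majorant_sum:
  assumes g: "g \<in> borel_measurable lebesgue" and d: "0 < d"
  shows "(\<Sum>n. majorant g (d * 2 ^ n) * ennreal (d * 2 ^ n))
           \<le> 2 * (\<integral>\<^sup>+x\<in>{-pi..pi}. majorant g x \<partial>lebesgue)"
proof -
  let ?I = "\<lambda>n. {d * 2 ^ n / 2<..d * 2 ^ n}"
  have disj: "m = n" if "t \<in> ?I m" "t \<in> ?I n" for t m n
  proof -
    have *: "\<not> m < n" if "t \<in> ?I m" "t \<in> ?I n" for m n
    proof
      assume "m < n"
      then have "(2::real) ^ Suc m \<le> 2 ^ n" by (intro power_increasing) auto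
      with d have "d * 2 ^ m \<le> d * 2 ^ n / 2" by simp
      with that show False by auto
    qed
    from *[OF that] *[OF that(2,1)] show ?thesis by simp
  qed
  have "(\<Sum>n. majorant g (d * 2 ^ n) * ennreal (d * 2 ^ n))
      = (\<Sum>n. 2 * (\<integral>\<^sup>+t. majorant g (d * 2 ^ n) * indicator (?I n) t \<partial>lebesgue))"
  proof (rule arg_cong[where f=suminf], rule ext)
    fix n
    have "ennreal (d * 2 ^ n) = 2 * ennreal (d * 2 ^ n - d * 2 ^ n / 2)"
      using d by (simp add: ennreal_mult'[symmetric] flip: ennreal_numeral)
    then show "majorant g (d * 2 ^ n) * ennreal (d * 2 ^ n)
       = 2 * (\<integral>\<^sup>+t. majorant g (d * 2 ^ n) * indicator (?I n) t \<partial>lebesgue)"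
      using d by (subst nn_integral_cmult_indicator) (auto simp: ac_simps)
  qed
  also have "\<dots> = 2 * (\<integral>\<^sup>+t. (\<Sum>n. majorant g (d * 2 ^ n) * indicator (?I n) t) \<partial>lebesgue)"
  proof -
    have "(\<lambda>t. majorant g (d * 2 ^ n) * indicator (?I n) t) \<in> borel_measurable lebesgue" for n
      by (intro borel_measurable_times_ennreal borel_measurable_indicator) simp_all
    then show ?thesis by (simp add: nn_integral_suminf)
  qed
  also have "\<dots> \<le> 2 * (\<integral>\<^sup>+x\<in>{-pi..pi}. majorant g x \<partial>lebesgue)"
  proof (intro mult_left_mono nn_integral_mono)
    fix t :: real
    show "(\<Sum>n. majorant g (d * 2 ^ n) * indicator (?I n) t) \<le> majorant g t * indicator {-pi..pi} t"
    proof (cases "\<exists>n. t \<in> ?I n")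
      case True
      then obtain n where n: "t \<in> ?I n" by blast
      have "(\<Sum>m. majorant g (d * 2 ^ m) * indicator (?I m) t) = majorant g (d * 2 ^ n)"
      proof -
        have "majorant g (d * 2 ^ m) * indicator (?I m) t = 0" if "m \<notin> {n}" for m
        proof -
          have "t \<notin> ?I m" using disj[OF _ n, of m] that by blast
          then show ?thesis by (subst indicator_simps(2)) (assumption, rule mult_zero_right)
        qed
        then have "(\<Sum>m. majorant g (d * 2 ^ m) * indicator (?I m) t)
          = (\<Sum>m\<in>{n}. majorant g (d * 2 ^ m) * indicator (?I m) t)"
          by (intro suminf_finite) simp_all
        also have "\<dots> = majorant g (d * 2 ^ n)"
          by (simp only: finite.emptyI sum.insert empty_iff not_False_eq_True sum.empty add_0_right
              indicator_simps(1)[OF n] mult_1_right)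
        finally show ?thesis .
      qed
      also have "\<dots> \<le> majorant g t * indicator {-pi..pi} t"
      proof (cases "d * 2 ^ n \<le> pi")
        case True
        have "0 < d * 2 ^ n" using d by simp
        then have "t \<in> {-pi..pi}" "majorant g (d * 2 ^ n) \<le> majorant g t"
          using n True by (auto intro!: majorant_mono[OF g])
        then show ?thesis by simp
      next
        case False
        then have "majorant g (d * 2 ^ n) = 0" by (intro majorant_eq_0[OF g]) linarith
        then show ?thesis by simp
      qed
      finally show ?thesis .
    next
      case False
      then have "indicator (?I n) t = (0::ennreal)" for n by (subst indicator_simps(2)) auto
      then show ?thesis by (simp only: mult_zero_right suminf_zero zero_le)
    qed
  qed simp
  finally show ?thesis .
qed

text \<open>
  A point with \<open>\<bar>t\<bar> > d\<close> lies in a shell \<open>2\<^sup>n d \<le> \<bar>t\<bar> < 2\<^bsup>n+1\<^esup> d\<close>, where the kernel is essentially at most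
  \<open>\<phi>\<^sup>*(2\<^sup>n d)\<close>.  Each shell is then enlarged to the full interval of radius \<open>2\<^bsup>n+1\<^esup> d\<close>, because averages of \<open>F\<close>
  over intervals are what the maximal function controls.  The terms with \<open>2\<^sup>n d > \<pi>\<close> vanish.
\<close>

lemma dyadic_kernel_bound:
  fixes F :: "real \<Rightarrow> ennreal"
  assumes g: "g \<in> borel_measurable lebesgue" and F: "F \<in> borel_measurable lebesgue" and d: "0 < d"
  shows "(\<integral>\<^sup>+t\<in>{-pi..pi}. ennreal (cmod (g t)) * F t \<partial>lebesgue)
    \<le> Linf_norm g * (\<integral>\<^sup>+t\<in>{-d..d}. F t \<partial>lebesgue)
      + (\<Sum>n. majorant g (d * 2 ^ n) * (\<integral>\<^sup>+t\<in>{-(2 * (d * 2 ^ n))..2 * (d * 2 ^ n)}. F t \<partial>lebesgue))"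
proof -
  let ?J = "\<lambda>n. {-(2 * (d * 2 ^ n))..2 * (d * 2 ^ n)}"
  have FI: "(\<lambda>t. F t * indicator {a..b} t) \<in> borel_measurable lebesgue" for a b
    by (intro borel_measurable_times_ennreal F borel_measurable_indicator) simp
  have "AE t in lebesgue. \<forall>n. \<bar>d * 2 ^ n\<bar> \<le> \<bar>t\<bar> \<and> \<bar>t\<bar> \<le> pi \<longrightarrow> ennreal (cmod (g t)) \<le> majorant g (d * 2 ^ n)"
    by (subst AE_all_countable) (intro allI AE_le_majorant[OF g])
  moreover note AE_le_majorant[OF g, of 0]
  ultimately have "AE t in lebesgue. ennreal (cmod (g t)) * F t * indicator {-pi..pi} t
    \<le> Linf_norm g * (F t * indicator {-d..d} t) + (\<Sum>n. majorant g (d * 2 ^ n) * (F t * indicator (?J n) t))"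
  proof eventually_elim
    case (elim t)
    show ?case
    proof (cases "\<bar>t\<bar> \<le> pi")
      case t: True
      show ?thesis
      proof (cases "\<bar>t\<bar> \<le> d")
        case True
        with t elim(2) show ?thesis
          by (intro add_increasing2) (auto simp: Linf_norm_eq_majorant abs_le_iff intro!: mult_right_mono)
      next
        case False
        obtain N where "\<bar>t\<bar> / d < 2 ^ N" using real_arch_pow[of 2 "\<bar>t\<bar> / d"] by auto
        then have N: "\<bar>t\<bar> < d * 2 ^ N" using d by (simp add: field_simps)
        define n where "n = (LEAST n. \<bar>t\<bar> < d * 2 ^ n)"
        have n: "\<bar>t\<bar> < d * 2 ^ n" unfolding n_def by (rule LeastI, rule N)
        have "n \<noteq> 0" using n False by (intro notI) auto
        then obtain m where m: "n = Suc m" by (cases n) auto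
        have "\<not> \<bar>t\<bar> < d * 2 ^ m" unfolding n_def by (rule not_less_Least) (simp add: m flip: n_def)
        then have le: "\<bar>d * 2 ^ m\<bar> \<le> \<bar>t\<bar>" using d by (simp add: abs_mult)
        have "ennreal (cmod (g t)) * F t * indicator {-pi..pi} t \<le> majorant g (d * 2 ^ m) * (F t * indicator (?J m) t)"
        proof -
          have "ennreal (cmod (g t)) \<le> majorant g (d * 2 ^ m)" using elim(1) le t by blast
          moreover have "t \<in> ?J m" "t \<in> {-pi..pi}" using n t m by auto
          ultimately show ?thesis by (simp add: mult_right_mono)
        qed
        also have "\<dots> = (\<Sum>n\<in>{m}. majorant g (d * 2 ^ n) * (F t * indicator (?J n) t))" by simp
        also have "\<dots> \<le> (\<Sum>n. majorant g (d * 2 ^ n) * (F t * indicator (?J n) t))"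
          by (intro sum_le_suminf) auto
        finally show ?thesis by (rule add_increasing[rotated]) simp
      qed
    next
      case False
      then have "t \<notin> {-pi..pi}" by auto
      then show ?thesis by simp
    qed
  qed
  then have "(\<integral>\<^sup>+t\<in>{-pi..pi}. ennreal (cmod (g t)) * F t \<partial>lebesgue)
    \<le> (\<integral>\<^sup>+t. Linf_norm g * (F t * indicator {-d..d} t) + (\<Sum>n. majorant g (d * 2 ^ n) * (F t * indicator (?J n) t)) \<partial>lebesgue)"
    by (rule nn_integral_mono_AE)
  also have "\<dots> = Linf_norm g * (\<integral>\<^sup>+t\<in>{-d..d}. F t \<partial>lebesgue)
      + (\<Sum>n. majorant g (d * 2 ^ n) * (\<integral>\<^sup>+t\<in>?J n. F t \<partial>lebesgue))"
    using FI by (simp add: nn_integral_add nn_integral_suminf nn_integral_cmult)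
  finally show ?thesis .
qed

section \<open>Averages and the Hardy--Littlewood maximal function\<close>

text \<open>
  This is Hoelder's inequality up to the factor \<open>2\<close>.  For every level \<open>a > 0\<close>,
  \<open>F \<le> a + a\<^bsup>1-p\<^esup> F\<^sup>p\<close> holds pointwise; integrate this and choose \<open>a\<close> so that both terms become equal.
\<close>

lemma set_nn_integral_power_mean:
  fixes F :: "real \<Rightarrow> real"
  assumes F: "F \<in> borel_measurable lebesgue" "\<And>t. 0 \<le> F t" and S: "S \<in> sets lebesgue"
    and p: "1 \<le> p" and L: "0 < L" "emeasure lebesgue S \<le> ennreal L"
    and J: "0 \<le> J" "(\<integral>\<^sup>+t\<in>S. ennreal (F t powr p) \<partial>lebesgue) \<le> ennreal J"
  shows "(\<integral>\<^sup>+t\<in>S. ennreal (F t) \<partial>lebesgue) \<le> ennreal (2 * L powr (1 - 1 / p) * J powr (1 / p))"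
proof (cases "J = 0")
  case True
  have Fp: "(\<lambda>t. ennreal (F t powr p) * indicator S t) \<in> borel_measurable lebesgue"
    using F(1) S by (intro borel_measurable_times_ennreal borel_measurable_indicator) auto
  have "(\<integral>\<^sup>+t\<in>S. ennreal (F t powr p) \<partial>lebesgue) = 0" using J True by simp
  then have "AE t in lebesgue. ennreal (F t powr p) * indicator S t = 0"
    using nn_integral_0_iff_AE[OF Fp] by simp
  then have "AE t in lebesgue. ennreal (F t) * indicator S t \<le> 0"
    by eventually_elim (auto simp: indicator_def split: if_splits)
  then have "(\<integral>\<^sup>+t\<in>S. ennreal (F t) \<partial>lebesgue) \<le> integral\<^sup>N lebesgue (\<lambda>t::real. 0)"
    by (rule nn_integral_mono_AE)
  then show ?thesis by simp
next
  case False
  with J have J0: "0 < J" by simp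
  \<comment> \<open>For \<open>J = 0\<close>, treated above, this level would be \<open>0\<close>.\<close>
  define a where "a = (J / L) powr (1 / p)"
  have a: "0 < a" using J0 L by (simp add: a_def)
  have ap: "a powr p = J / L" using J0 L p by (simp add: a_def powr_powr)
  have pt: "F t \<le> a + a powr (1 - p) * F t powr p" for t
  proof (cases "F t \<le> a")
    case False
    then have "a powr (p - 1) \<le> F t powr (p - 1)" using a p by (intro powr_mono2) auto
    then have "a powr (1 - p) * a powr (p - 1) \<le> a powr (1 - p) * F t powr (p - 1)"
      by (intro mult_left_mono) auto
    then have "1 \<le> a powr (1 - p) * F t powr (p - 1)"
      using a by (simp flip: powr_add)
    then have "F t * 1 \<le> F t * (a powr (1 - p) * F t powr (p - 1))"
      by (intro mult_left_mono F)
    also have "\<dots> = a powr (1 - p) * F t powr p"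
      using False a by (simp add: powr_diff)
    finally show ?thesis using a by simp
  qed (simp add: add_increasing2)
  have "(\<integral>\<^sup>+t\<in>S. ennreal (F t) \<partial>lebesgue)
      \<le> (\<integral>\<^sup>+t. ennreal a * indicator S t + ennreal (a powr (1 - p)) * (ennreal (F t powr p) * indicator S t) \<partial>lebesgue)"
    using pt a by (intro nn_integral_mono) (auto simp: indicator_def simp flip: ennreal_plus ennreal_mult)
  also have "\<dots> = ennreal a * emeasure lebesgue S
      + ennreal (a powr (1 - p)) * (\<integral>\<^sup>+t\<in>S. ennreal (F t powr p) \<partial>lebesgue)"
  proof -
    have "(\<lambda>t. ennreal (F t powr p) * indicator S t) \<in> borel_measurable lebesgue"
      using F(1) S by (intro borel_measurable_times_ennreal borel_measurable_indicator) auto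
    then show ?thesis using S by (simp add: nn_integral_add nn_integral_cmult nn_integral_cmult_indicator)
  qed
  also have "\<dots> \<le> ennreal a * ennreal L + ennreal (a powr (1 - p)) * ennreal J"
    using L J by (intro add_mono mult_left_mono) auto
  also have "\<dots> = ennreal (a * L + a powr (1 - p) * J)"
    using a L J by (simp add: ennreal_mult)
  also have "a powr (1 - p) * J = a * L"
    using a ap J0 L by (simp add: powr_diff field_simps)
  also have "a * L + a * L = 2 * L powr (1 - 1 / p) * J powr (1 / p)"
    using L J0 by (simp add: a_def powr_divide powr_diff)
  finally show ?thesis .
qed

lemma set_nn_integral_le_HL_maximal:
  assumes "0 < s"
  shows "(\<integral>\<^sup>+u\<in>{x-s..x+s}. ennreal \<bar>g u\<bar> \<partial>lebesgue) \<le> ennreal (2 * s) * HL_maximal g x"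
proof -
  let ?I = "\<integral>\<^sup>+u\<in>{x-s..x+s}. ennreal \<bar>g u\<bar> \<partial>lebesgue"
  have "?I = ennreal (2 * s) * (?I / ennreal (2 * s))"
    using assms by (simp add: mult.commute[of "ennreal (2 * s)"] ennreal_divide_times ennreal_times_divide ennreal_mult_divide_eq)
  also have "\<dots> \<le> ennreal (2 * s) * HL_maximal g x"
    using assms unfolding HL_maximal_def by (intro mult_left_mono SUP_upper2[of s]) auto
  finally show ?thesis .
qed

lemma powr_add_le:
  fixes a b q :: real
  assumes "0 < a" "0 < b" "0 \<le> q" "q \<le> 1"
  shows "(a + b) powr q \<le> a powr q + b powr q"
proof -
  have *: "c / (a + b) \<le> (c / (a + b)) powr q" if "0 < c" "c \<le> a + b" for c
    using powr_mono'[of q 1 "c / (a + b)"] that assms by simp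
  have "1 = a / (a + b) + b / (a + b)" using assms by (simp flip: add_divide_distrib)
  also have "\<dots> \<le> (a / (a + b)) powr q + (b / (a + b)) powr q"
    using assms by (intro add_mono *) auto
  also have "\<dots> = (a powr q + b powr q) / (a + b) powr q"
    using assms by (simp add: powr_divide add_divide_distrib)
  finally show ?thesis using assms by (simp add: field_simps)
qed

text \<open>
  Hoelder's inequality is applied on \<open>[y - s, y + s]\<close>, but the integral of \<open>F\<^sup>p\<close> is estimated over the larger interval
  \<open>[x - (s + l), x + (s + l)]\<close>, which is centred at \<open>x\<close>.  In this way \<open>l\<close> enters only with the power \<open>1/p\<close>.
\<close>

lemma nearby_average_le_HL_maximal:
  fixes F :: "real \<Rightarrow> real"
  assumes F: "F \<in> borel_measurable lebesgue" "\<And>t. 0 \<le> F t"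
    and p: "1 \<le> p" and m: "0 \<le> m" "HL_maximal (\<lambda>u. F u powr p) x \<le> ennreal m"
    and y: "\<bar>x - y\<bar> < l" and s: "0 < s"
  shows "(\<integral>\<^sup>+t\<in>{-s..s}. ennreal (F (y - t)) \<partial>lebesgue)
    \<le> ennreal (4 * m powr (1 / p) * (s + s powr (1 - 1 / p) * l powr (1 / p)))"
proof -
  have l: "0 < l" using y by linarith
  have "(\<integral>\<^sup>+t\<in>{y-s..y+s}. ennreal (F t powr p) \<partial>lebesgue)
      \<le> (\<integral>\<^sup>+t\<in>{x-(s+l)..x+(s+l)}. ennreal \<bar>F t powr p\<bar> \<partial>lebesgue)"
    using y by (intro nn_integral_mono) (auto simp: indicator_def)
  also have "\<dots> \<le> ennreal (2 * (s + l)) * HL_maximal (\<lambda>u. F u powr p) x"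
    using s l by (intro set_nn_integral_le_HL_maximal) simp
  also have "\<dots> \<le> ennreal (2 * (s + l)) * ennreal m" by (intro mult_left_mono m) simp
  also have "\<dots> = ennreal (2 * (s + l) * m)" using s l m by (simp add: ennreal_mult)
  finally have J: "(\<integral>\<^sup>+t\<in>{y-s..y+s}. ennreal (F t powr p) \<partial>lebesgue) \<le> ennreal (2 * (s + l) * m)" .
  have "(\<integral>\<^sup>+t\<in>{-s..s}. ennreal (F (y - t)) \<partial>lebesgue) = (\<integral>\<^sup>+t\<in>{y-s..y+s}. ennreal (F t) \<partial>lebesgue)"
    using set_nn_integral_reflect[where F="\<lambda>t. ennreal (F t)" and a="-s" and b=s and y=y] F by simp
  also have "\<dots> \<le> ennreal (2 * (2 * s) powr (1 - 1 / p) * (2 * (s + l) * m) powr (1 / p))"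
    using s l m by (intro set_nn_integral_power_mean[OF F _ p _ _ _ J]) auto
  also have "\<dots> \<le> ennreal (4 * m powr (1 / p) * (s + s powr (1 - 1 / p) * l powr (1 / p)))"
  proof (rule ennreal_leI)
    have "2 * (2 * s) powr (1 - 1 / p) * (2 * (s + l) * m) powr (1 / p)
        = 4 * m powr (1 / p) * (s powr (1 - 1 / p) * (s + l) powr (1 / p))"
    proof -
      have "(2 * s) powr (1 - 1 / p) = 2 powr (1 - 1 / p) * s powr (1 - 1 / p)"
        "(2 * (s + l) * m) powr (1 / p) = 2 powr (1 / p) * (s + l) powr (1 / p) * m powr (1 / p)"
        using s l m by (simp_all only: powr_mult)
      moreover have "2 powr (1 - 1 / p) * 2 powr (1 / p) = (2::real)" by (simp flip: powr_add)
      ultimately show ?thesis by algebra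
    qed
    also have "\<dots> \<le> 4 * m powr (1 / p) * (s powr (1 - 1 / p) * (s powr (1 / p) + l powr (1 / p)))"
      using s l p by (intro mult_left_mono powr_add_le) auto
    also have "s powr (1 - 1 / p) * (s powr (1 / p) + l powr (1 / p)) = s + s powr (1 - 1 / p) * l powr (1 / p)"
      using s by (simp add: distrib_left flip: powr_add)
    finally show "2 * (2 * s) powr (1 - 1 / p) * (2 * (s + l) * m) powr (1 / p)
      \<le> 4 * m powr (1 / p) * (s + s powr (1 - 1 / p) * l powr (1 / p))" .
  qed
  finally show ?thesis .
qed

section \<open>The pointwise estimate for one kernel\<close>

text \<open>
  The radius \<open>d = B / A\<close>, with \<open>A\<close> the norm and \<open>B\<close> the weighted supremum of the kernel, is the point where the two
  bounds \<open>\<phi>\<^sup>* \<le> A\<close> and \<open>\<phi>\<^sup>*(t) \<le> B / \<bar>t\<bar>\<close> coincide.  With this \<open>d\<close> the \<open>l\<close>-part of the central term and that of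
  the shells are multiples of the same quantity \<open>A\<^bsup>\<theta>\<^esup> B\<^bsup>1-\<theta>\<^esup> l\<^bsup>\<theta>\<^esup> = (l A B\<^bsup>p-1\<^esup>)\<^bsup>\<theta>\<^esup>\<close>, where \<open>\<theta> = 1/p\<close>.
\<close>

lemma kernel_integral_le_HL_maximal:
  fixes F :: "real \<Rightarrow> real"
  assumes g: "g \<in> borel_measurable lebesgue" "Linf_norm g < top"
    and c: "0 \<le> c" "(\<integral>\<^sup>+x\<in>{-pi..pi}. majorant g x \<partial>lebesgue) \<le> ennreal c"
    and K: "0 \<le> K" "ennreal l * Linf_norm g * ennreal_power (weighted_sup g) (p - 1) \<le> ennreal K"
    and F: "F \<in> borel_measurable lebesgue" "\<And>t. 0 \<le> F t"
    and p: "1 \<le> p" and m: "0 \<le> m" "HL_maximal (\<lambda>u. F u powr p) x \<le> ennreal m"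
    and y: "\<bar>x - y\<bar> < l"
  shows "(\<integral>\<^sup>+t\<in>{-pi..pi}. ennreal (cmod (g t)) * ennreal (F (y - t)) \<partial>lebesgue)
    \<le> ennreal ((20 * c + 12 * K powr (1 / p) / (1 - 2 powr (- 1 / p))) * m powr (1 / p))"
proof -
  have l: "0 < l" using y by linarith
  define \<theta> where "\<theta> = 1 / p"
  have \<theta>: "0 < \<theta>" "\<theta> \<le> 1" using p by (auto simp: \<theta>_def)
  define \<mu> where "\<mu> = m powr \<theta>"
  define q where "q = 2 powr - \<theta>"
  have q: "0 < q" "q < 1" using \<theta> by (auto simp: q_def powr_less_one)
  have \<mu>: "0 \<le> \<mu>" by (simp add: \<mu>_def)
  let ?N = "\<lambda>s. \<integral>\<^sup>+t\<in>{-s..s}. ennreal (F (y - t)) \<partial>lebesgue"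
  have N: "?N s \<le> ennreal (4 * \<mu> * (s + s powr (1 - \<theta>) * l powr \<theta>))" if "0 < s" for s
    using nearby_average_le_HL_maximal[OF F p m y that] by (simp add: \<mu>_def \<theta>_def)
  have Fy: "(\<lambda>t. ennreal (F (y - t))) \<in> borel_measurable lebesgue"
    using measurable_compose[OF measurable_lebesgue_reflect F(1)] by simp
  note split = dyadic_kernel_bound[OF g(1) Fy]
  show ?thesis
  proof (cases "Linf_norm g = 0")
    case True
    have "majorant g z = 0" for z
      using majorant_mono[OF g(1), of 0 z] True by (simp add: Linf_norm_eq_majorant)
    with split[of 1] True show ?thesis by simp
  next
    case False
    obtain a where a: "Linf_norm g = ennreal a" "0 < a"
      using False g(2) by (cases "Linf_norm g") (auto simp: less_top)
    have wle: "weighted_sup g \<le> ennreal c"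
      using weighted_sup_le_integral[OF g(1)] c(2) by (rule order_trans)
    moreover have "0 < weighted_sup g" using weighted_sup_pos[OF g(1)] a by simp
    ultimately obtain b where b: "weighted_sup g = ennreal b" "0 < b"
      by (cases "weighted_sup g") (auto simp: top_unique)
    have bc: "b \<le> c" using wle b c by simp
    have "ennreal_power (weighted_sup g) (p - 1) = ennreal (b powr (p - 1))"
      using b by (auto simp: ennreal_power_def)
    then have "ennreal (l * a * b powr (p - 1)) \<le> ennreal K"
      using K(2) a b l by (simp add: ennreal_mult)
    then have "l * a * b powr (p - 1) \<le> K" using K(1) by simp
    then have "(l * a * b powr (p - 1)) powr \<theta> \<le> K powr \<theta>"
      using l a b \<theta> by (intro powr_mono2) auto
    also have "(l * a * b powr (p - 1)) powr \<theta> = a powr \<theta> * b powr (1 - \<theta>) * l powr \<theta>"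
      using l a b p by (simp add: powr_mult powr_powr \<theta>_def diff_divide_distrib)
    finally have k: "a powr \<theta> * b powr (1 - \<theta>) * l powr \<theta> \<le> K powr \<theta>" .
    define d where "d = b / a"
    have d: "0 < d" using a b by (simp add: d_def)
    \<comment> \<open>The next three identities balance the central term against the shells.\<close>
    have ad: "a * d = b" using a by (simp add: d_def)
    have ad1: "a * d powr (1 - \<theta>) = a powr \<theta> * b powr (1 - \<theta>)"
      using a b by (simp add: d_def powr_divide powr_diff)
    have bd: "b * d powr - \<theta> = a powr \<theta> * b powr (1 - \<theta>)"
      using a b by (simp add: d_def powr_divide powr_diff powr_minus field_simps)

    have "Linf_norm g * ?N d \<le> ennreal a * ennreal (4 * \<mu> * (d + d powr (1 - \<theta>) * l powr \<theta>))"
      unfolding a(1) by (intro mult_left_mono N d) simp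
    also have "\<dots> = ennreal (4 * \<mu> * (a * d + a * d powr (1 - \<theta>) * l powr \<theta>))"
      using a by (simp add: algebra_simps flip: ennreal_mult')
    also have "\<dots> \<le> ennreal (4 * \<mu> * (c + K powr \<theta>))"
      unfolding ad ad1 using \<mu> bc k by (intro ennreal_leI mult_left_mono add_mono) auto
    finally have central: "Linf_norm g * ?N d \<le> ennreal (4 * \<mu> * (c + K powr \<theta>))" .

    \<comment> \<open>The first summand is a term of the Riemann sum of the majorant, the second one of a geometric series.\<close>
    have shell: "majorant g (d * 2 ^ n) * ?N (2 * (d * 2 ^ n))
      \<le> ennreal (8 * \<mu>) * (majorant g (d * 2 ^ n) * ennreal (d * 2 ^ n)) + ennreal (8 * \<mu> * K powr \<theta> * q ^ n)" for n
    proof -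
      define r where "r = d * 2 ^ n"
      have r: "0 < r" using d by (simp add: r_def)
      have "(2 * r) powr (1 - \<theta>) \<le> 2 * (r * r powr - \<theta>)"
      proof -
        have "2 powr (1 - \<theta>) \<le> 2 powr (1::real)" using \<theta> by (intro powr_mono) auto
        then have "2 powr (1 - \<theta>) * r powr (1 - \<theta>) \<le> 2 * r powr (1 - \<theta>)"
          by (intro mult_right_mono) auto
        then show ?thesis using r by (simp add: powr_mult powr_diff powr_minus field_simps)
      qed
      then have "4 * \<mu> * (2 * r + (2 * r) powr (1 - \<theta>) * l powr \<theta>)
        \<le> 4 * \<mu> * (2 * r + 2 * (r * r powr - \<theta>) * l powr \<theta>)"
        using \<mu> by (intro mult_left_mono add_left_mono mult_right_mono) auto
      also have "\<dots> = 8 * \<mu> * r + 8 * \<mu> * l powr \<theta> * r powr - \<theta> * r"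
        by (simp add: algebra_simps)
      finally have "?N (2 * r) \<le> ennreal (8 * \<mu> * r + 8 * \<mu> * l powr \<theta> * r powr - \<theta> * r)"
        using N[of "2 * r"] r by (intro order_trans[OF N ennreal_leI]) auto
      also have "\<dots> = ennreal (8 * \<mu>) * ennreal r + ennreal (8 * \<mu> * l powr \<theta> * r powr - \<theta>) * ennreal r"
        using r \<mu> by (simp add: ennreal_mult)
      finally have "majorant g r * ?N (2 * r)
        \<le> majorant g r * (ennreal (8 * \<mu>) * ennreal r + ennreal (8 * \<mu> * l powr \<theta> * r powr - \<theta>) * ennreal r)"
        by (intro mult_left_mono) auto
      also have "\<dots> = ennreal (8 * \<mu>) * (majorant g r * ennreal r)
          + ennreal (8 * \<mu> * l powr \<theta> * r powr - \<theta>) * (ennreal r * majorant g r)"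
        by (simp add: distrib_left ac_simps)
      also have "\<dots> \<le> ennreal (8 * \<mu>) * (majorant g r * ennreal r)
          + ennreal (8 * \<mu> * l powr \<theta> * r powr - \<theta>) * ennreal b"
        using weighted_sup_upper[OF g(1), of r] r b(1) by (intro add_left_mono mult_left_mono) auto
      also have "ennreal (8 * \<mu> * l powr \<theta> * r powr - \<theta>) * ennreal b = ennreal (8 * \<mu> * (b * r powr - \<theta> * l powr \<theta>))"
        using b by (simp add: ac_simps flip: ennreal_mult')
      also have "b * r powr - \<theta> * l powr \<theta> = a powr \<theta> * b powr (1 - \<theta>) * l powr \<theta> * q ^ n"
      proof -
        have "(2 ^ n) powr - \<theta> = q ^ n"
          by (simp add: q_def powr_powr powr_realpow[symmetric] mult.commute flip: powr_realpow)
        then have "r powr - \<theta> = d powr - \<theta> * q ^ n" using d by (simp add: r_def powr_mult)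
        then show ?thesis using bd by (simp add: mult.assoc[symmetric]) 
      qed
      also have "ennreal (8 * \<mu> * (a powr \<theta> * b powr (1 - \<theta>) * l powr \<theta> * q ^ n)) \<le> ennreal (8 * \<mu> * (K powr \<theta> * q ^ n))"
        using \<mu> k q by (intro ennreal_leI mult_left_mono mult_right_mono) auto
      finally show ?thesis by (simp add: r_def mult.assoc add_left_mono)
    qed

    have "(\<Sum>n. majorant g (d * 2 ^ n) * ?N (2 * (d * 2 ^ n)))
      \<le> (\<Sum>n. ennreal (8 * \<mu>) * (majorant g (d * 2 ^ n) * ennreal (d * 2 ^ n)) + ennreal (8 * \<mu> * K powr \<theta> * q ^ n))"
      by (intro suminf_le shell) auto
    also have "\<dots> = ennreal (8 * \<mu>) * (\<Sum>n. majorant g (d * 2 ^ n) * ennreal (d * 2 ^ n)) + (\<Sum>n. ennreal (8 * \<mu> * K powr \<theta> * q ^ n))"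
      by (simp add: suminf_add[symmetric])
    also have "(\<Sum>n. ennreal (8 * \<mu> * K powr \<theta> * q ^ n)) = ennreal (8 * \<mu> * K powr \<theta> * (1 / (1 - q)))"
      using q \<mu> by (intro suminf_ennreal_eq sums_mult geometric_sums) auto
    also have "ennreal (8 * \<mu>) * (\<Sum>n. majorant g (d * 2 ^ n) * ennreal (d * 2 ^ n)) \<le> ennreal (8 * \<mu>) * (2 * ennreal c)"
      by (intro mult_left_mono order_trans[OF dyadic_majorant_sum[OF g(1) d]] c) auto
    also have "ennreal (8 * \<mu>) * (2 * ennreal c) = ennreal (16 * \<mu> * c)"
      using \<mu> c by (simp add: ac_simps flip: ennreal_mult ennreal_numeral)
    finally have shells: "(\<Sum>n. majorant g (d * 2 ^ n) * ?N (2 * (d * 2 ^ n)))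
      \<le> ennreal (16 * \<mu> * c) + ennreal (8 * \<mu> * K powr \<theta> * (1 / (1 - q)))"
      by (simp add: add_right_mono)

    have "(\<integral>\<^sup>+t\<in>{-pi..pi}. ennreal (cmod (g t)) * ennreal (F (y - t)) \<partial>lebesgue)
      \<le> ennreal (4 * \<mu> * (c + K powr \<theta>)) + (ennreal (16 * \<mu> * c) + ennreal (8 * \<mu> * K powr \<theta> * (1 / (1 - q))))"
      by (rule order_trans[OF split[OF d] add_mono[OF central shells]])
    also have "\<dots> = ennreal (\<mu> * (20 * c + (4 * K powr \<theta> + 8 * K powr \<theta> / (1 - q))))"
      using \<mu> c q by (simp add: algebra_simps flip: ennreal_plus)
    also have "\<dots> \<le> ennreal (\<mu> * (20 * c + (4 * K powr \<theta> / (1 - q) + 8 * K powr \<theta> / (1 - q))))"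
    proof -
      have "4 * K powr \<theta> * 1 \<le> 4 * K powr \<theta> * (1 / (1 - q))" using q by (intro mult_left_mono) auto
      then show ?thesis using \<mu> by (intro ennreal_leI mult_left_mono add_left_mono add_right_mono) auto
    qed
    also have "\<dots> = ennreal ((20 * c + 12 * K powr (1 / p) / (1 - 2 powr (- 1 / p))) * m powr (1 / p))"
      by (simp add: q_def \<theta>_def \<mu>_def mult.commute flip: add_divide_distrib)
    finally show ?thesis .
  qed
qed

section \<open>The weak-type inequality for the maximal function of a periodic function\<close>

lemma set_nn_integral_periods:
  fixes F :: "real \<Rightarrow> ennreal"
  assumes F: "F \<in> borel_measurable lebesgue" and per: "\<And>t. F (t + 2 * pi) = F t"
  shows "(\<integral>\<^sup>+t\<in>{a..a + 2 * pi * real k}. F t \<partial>lebesgue) \<le> of_nat k * (\<integral>\<^sup>+t\<in>{-pi..pi}. F t \<partial>lebesgue)"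
proof (induction k)
  case 0
  have "AE t in lebesgue. t \<noteq> a" by (intro AE_completion AE_lborel_singleton)
  then have "AE t in lebesgue. F t * indicator {a..a + 2 * pi * real 0} t = 0"
    by eventually_elim auto
  then have "(\<integral>\<^sup>+t\<in>{a..a + 2 * pi * real 0}. F t \<partial>lebesgue) = integral\<^sup>N lebesgue (\<lambda>t::real. 0)"
    by (rule nn_integral_cong_AE)
  then show ?case by simp
next
  case (Suc k)
  let ?b = "a + 2 * pi * real k"
  have m: "(\<lambda>t. F t * indicator {u..v} t) \<in> borel_measurable lebesgue" for u v
    by (intro borel_measurable_times_ennreal F borel_measurable_indicator) simp
  have "(\<integral>\<^sup>+t\<in>{a..a + 2 * pi * real (Suc k)}. F t \<partial>lebesgue)
      \<le> (\<integral>\<^sup>+t. F t * indicator {a..?b} t + F t * indicator {?b..?b + 2 * pi} t \<partial>lebesgue)"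
    by (intro nn_integral_mono) (auto simp: indicator_def algebra_simps)
  also have "\<dots> = (\<integral>\<^sup>+t\<in>{a..?b}. F t \<partial>lebesgue) + (\<integral>\<^sup>+t\<in>{-pi..pi}. F t \<partial>lebesgue)"
    using m by (simp add: nn_integral_add set_nn_integral_periodic[OF F per])
  also have "\<dots> \<le> of_nat (Suc k) * (\<integral>\<^sup>+t\<in>{-pi..pi}. F t \<partial>lebesgue)"
    using add_right_mono[OF Suc.IH, of "\<integral>\<^sup>+t\<in>{-pi..pi}. F t \<partial>lebesgue"]
    by (simp add: distrib_right add.commute)
  finally show ?case .
qed

lemma HL_maximal_gt_iff:
  assumes "0 \<le> s"
  shows "ennreal s < HL_maximal g x \<longleftrightarrow> (\<exists>t>0. ennreal (2 * t * s) < (\<integral>\<^sup>+u\<in>{x-t..x+t}. ennreal \<bar>g u\<bar> \<partial>lebesgue))"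
proof -
  have "ennreal s < J / ennreal (2 * t) \<longleftrightarrow> ennreal (2 * t * s) < J" if "0 < t" for t J
  proof (cases J)
    case (real j)
    with that assms show ?thesis
      by (simp add: divide_ennreal ennreal_less_iff field_simps)
  next
    case top
    with that show ?thesis by (simp add: ennreal_top_divide)
  qed
  then show ?thesis by (auto simp: HL_maximal_def less_SUP_iff)
qed

text \<open>
  Each \<open>x\<close> in \<open>E\<close> has a radius \<open>r\<^sub>x\<close> for which the average of \<open>F\<close> over \<open>[x - r\<^sub>x, x + r\<^sub>x]\<close> exceeds \<open>s\<close>.  If some
  \<open>r\<^sub>x\<close> is at least \<open>\<pi>\<close>, then by periodicity \<open>s\<close> is so small that the trivial bound \<open>\<bar>E\<bar> \<le> 2\<pi>\<close> suffices.
  Otherwise Vitali's lemma selects disjoint intervals whose fivefold dilates cover \<open>E\<close>; the selected intervals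
  lie in \<open>[-2\<pi>, 2\<pi>]\<close>, that is, in two periods, which gives the constant \<open>5 \<cdot> 2\<close>.
\<close>

lemma HL_maximal_weak_type_periodic:
  fixes F :: "real \<Rightarrow> real"
  assumes F: "F \<in> borel_measurable lebesgue" "\<And>t. 0 \<le> F t" and per: "\<And>t. F (t + 2 * pi) = F t"
    and I: "0 \<le> I" "(\<integral>\<^sup>+t\<in>{-pi..pi}. ennreal (F t) \<partial>lebesgue) = ennreal I"
    and s: "0 < s" and E: "E \<in> sets lebesgue" "E \<subseteq> {-pi..pi}" "\<And>x. x \<in> E \<Longrightarrow> ennreal s < HL_maximal F x"
  shows "emeasure lebesgue E \<le> ennreal (10 * I / s)"
proof -
  let ?F = "\<lambda>t. ennreal (F t)"
  have Fm: "?F \<in> borel_measurable lebesgue" using F by simp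
  have periods: "(\<integral>\<^sup>+t\<in>{a..a + 2 * pi * real k}. ?F t \<partial>lebesgue) \<le> ennreal (real k * I)" for a k
    using set_nn_integral_periods[OF Fm, of a k] per I by (simp add: ennreal_mult ennreal_of_nat_eq_real_of_nat)
  have "\<forall>x\<in>E. \<exists>t>0. ennreal (2 * t * s) < (\<integral>\<^sup>+u\<in>{x-t..x+t}. ?F u \<partial>lebesgue)"
    using E(3) s F(2) by (simp add: HL_maximal_gt_iff)
  then obtain r where r: "\<And>x. x \<in> E \<Longrightarrow> 0 < r x"
    "\<And>x. x \<in> E \<Longrightarrow> ennreal (2 * r x * s) < (\<integral>\<^sup>+u\<in>{x - r x..x + r x}. ?F u \<partial>lebesgue)"
    by metis
  show ?thesis
  proof (cases "\<exists>x\<in>E. pi \<le> r x")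
    case True
    then obtain x where x: "x \<in> E" "pi \<le> r x" by blast
    \<comment> \<open>The number of periods that cover the interval of radius \<open>r x\<close> about \<open>x\<close>.\<close>
    define k where "k = nat \<lceil>r x / pi\<rceil>"
    have q: "1 \<le> r x / pi" using x by simp
    have k: "r x / pi \<le> real k" "real k \<le> r x / pi + 1"
      unfolding k_def using q by linarith+
    have k1: "r x \<le> pi * real k" using k(1) by (simp add: field_simps)
    have "real k \<le> 2 * (r x / pi)" using k q by linarith
    then have k2: "real k * pi \<le> 2 * r x" by (simp add: field_simps)
    have "(\<integral>\<^sup>+u\<in>{x - r x..x + r x}. ?F u \<partial>lebesgue)
        \<le> (\<integral>\<^sup>+u\<in>{x - r x..x - r x + 2 * pi * real k}. ?F u \<partial>lebesgue)"
      using k1 by (intro nn_integral_mono) (auto simp: indicator_def)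
    also note periods
    finally have "ennreal (2 * r x * s) < ennreal (real k * I)" using r(2)[OF x(1)] by simp
    then have "2 * r x * s < real k * I" using I by (simp add: ennreal_less_iff r(1)[OF x(1)] less_imp_le s)
    then have "2 * r x * (s * pi) < (real k * pi) * I" by (simp add: field_simps)
    also have "\<dots> \<le> 2 * r x * I" using k2 I by (intro mult_right_mono)
    finally have "s * pi < I" using r(1)[OF x(1)] by simp
    then have "2 * pi \<le> 10 * I / s" using s I by (simp add: field_simps)
    have "emeasure lebesgue E \<le> emeasure lebesgue {-pi..pi}" using E by (intro emeasure_mono) auto
    also have "\<dots> = ennreal (2 * pi)" by simp
    also have "\<dots> \<le> ennreal (10 * I / s)" by (rule ennreal_leI) fact
    finally show ?thesis .
  next
    case False
    then have rpi: "\<And>x. x \<in> E \<Longrightarrow> 0 < r x \<and> r x \<le> pi" using r(1) by force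
    obtain C where C: "countable C" "C \<subseteq> E"
      and disj: "pairwise (\<lambda>i j. disjnt (cball i (r i)) (cball j (r j))) C"
      and cov: "E \<subseteq> (\<Union>i\<in>C. cball i (5 * r i))"
    proof (rule Vitali_covering_lemma_cballs[where S=E and K=E and a="\<lambda>i. i" and r=r and B=pi])
      show "E \<subseteq> (\<Union>i\<in>E. cball i (r i))" using rpi by force
    qed (use rpi in auto)
    \<comment> \<open>Sums over the countable family \<open>C\<close> are integrals for the counting measure, so that
      Tonelli's theorem turns both the covering and the disjointness into pointwise inequalities.\<close>
    have "emeasure lebesgue E \<le> emeasure lebesgue (\<Union>i\<in>C. cball i (5 * r i))"
      using cov C by (intro emeasure_mono sets.countable_UN') auto
    also have "\<dots> = (\<integral>\<^sup>+x. indicator (\<Union>i\<in>C. cball i (5 * r i)) x \<partial>lebesgue)"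
      using C by (subst nn_integral_indicator) (auto intro!: sets.countable_UN')
    also have "\<dots> \<le> (\<integral>\<^sup>+x. \<integral>\<^sup>+i. indicator (cball i (5 * r i)) x \<partial>count_space C \<partial>lebesgue)"
    proof (intro nn_integral_mono)
      fix x :: real
      show "indicator (\<Union>i\<in>C. cball i (5 * r i)) x \<le> (\<integral>\<^sup>+i. indicator (cball i (5 * r i)) x \<partial>count_space C)"
      proof (cases "x \<in> (\<Union>i\<in>C. cball i (5 * r i))")
        case True
        then obtain j where j: "j \<in> C" "x \<in> cball j (5 * r j)" by blast
        have "1 = (\<integral>\<^sup>+i. indicator {j} i \<partial>count_space C)" using j by simp
        also have "\<dots> \<le> (\<integral>\<^sup>+i. indicator (cball i (5 * r i)) x \<partial>count_space C)"
          using j by (intro nn_integral_mono) (auto simp: indicator_def)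
        finally show ?thesis by (simp add: indicator_def)
      qed simp
    qed
    also have "\<dots> = (\<integral>\<^sup>+i. emeasure lebesgue (cball i (5 * r i)) \<partial>count_space C)"
      using C by (subst nn_integral_count_space_nn_integral) (auto intro!: borel_measurable_indicator)
    also have "\<dots> \<le> (\<integral>\<^sup>+i. ennreal (5 / s) * (\<integral>\<^sup>+x\<in>cball i (r i). ?F x \<partial>lebesgue) \<partial>count_space C)"
    proof (intro nn_integral_mono)
      fix i assume "i \<in> space (count_space C)"
      then have i: "i \<in> E" using C by auto
      have "emeasure lebesgue (cball i (5 * r i)) = ennreal (5 / s) * ennreal (2 * r i * s)"
        using rpi[OF i] s by (simp add: cball_eq_atLeastAtMost ennreal_mult'[symmetric])
      also have "\<dots> \<le> ennreal (5 / s) * (\<integral>\<^sup>+x\<in>cball i (r i). ?F x \<partial>lebesgue)"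
        using r(2)[OF i] by (intro mult_left_mono) (simp_all add: cball_eq_atLeastAtMost less_imp_le)
      finally show "emeasure lebesgue (cball i (5 * r i)) \<le> ennreal (5 / s) * (\<integral>\<^sup>+x\<in>cball i (r i). ?F x \<partial>lebesgue)" .
    qed
    also have "\<dots> = ennreal (5 / s) * (\<integral>\<^sup>+x. \<integral>\<^sup>+i. ?F x * indicator (cball i (r i)) x \<partial>count_space C \<partial>lebesgue)"
      using C Fm by (subst nn_integral_count_space_nn_integral)
        (auto simp: nn_integral_cmult intro!: borel_measurable_times_ennreal borel_measurable_indicator)
    also have "\<dots> \<le> ennreal (5 / s) * (\<integral>\<^sup>+x\<in>{-2*pi..-2*pi+2*pi*real 2}. ?F x \<partial>lebesgue)"
    proof (intro mult_left_mono nn_integral_mono)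
      fix x :: real
      show "(\<integral>\<^sup>+i. ?F x * indicator (cball i (r i)) x \<partial>count_space C) \<le> ?F x * indicator {-2*pi..-2*pi+2*pi*real 2} x"
      proof (cases "\<exists>j\<in>C. x \<in> cball j (r j)")
        case True
        then obtain j where j: "j \<in> C" "x \<in> cball j (r j)" by blast
        have "j \<in> E" using j C by blast
        then have "\<bar>j\<bar> \<le> pi" "r j \<le> pi" "\<bar>x - j\<bar> \<le> r j"
          using E(2) rpi j(2) by (auto simp: dist_real_def abs_le_iff)
        then have x: "x \<in> {-2*pi..-2*pi+2*pi*real 2}" by auto
        have "(\<integral>\<^sup>+i. ?F x * indicator (cball i (r i)) x \<partial>count_space C) \<le> (\<integral>\<^sup>+i. ?F x * indicator {j} i \<partial>count_space C)"
        proof (intro nn_integral_mono)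
          fix i assume "i \<in> space (count_space C)"
          then have "x \<notin> cball i (r i)" if "i \<noteq> j"
            using disj j that unfolding pairwise_def disjnt_def by fastforce
          then show "?F x * indicator (cball i (r i)) x \<le> ?F x * indicator {j} i"
            by (auto simp: indicator_def)
        qed
        also have "\<dots> = ?F x" using j by (simp add: nn_integral_cmult)
        finally show ?thesis using x by simp
      next
        case False
        then have "(\<integral>\<^sup>+i. ?F x * indicator (cball i (r i)) x \<partial>count_space C) = (\<integral>\<^sup>+i. 0 \<partial>count_space C)"
          by (intro nn_integral_cong) (auto simp: indicator_def)
        then show ?thesis by simp
      qed
    qed simp
    also have "\<dots> \<le> ennreal (5 / s) * ennreal (real 2 * I)" by (intro mult_left_mono periods) simp
    also have "\<dots> = ennreal (10 * I / s)" using s I by (simp flip: ennreal_mult')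
    finally show ?thesis .
  qed
qed

section \<open>The maximal operator of the approximate identity\<close>

text \<open>
  If the product is not integrable, the Bochner integral is \<open>0\<close> and the bound is trivial.  Otherwise take absolute
  values and substitute \<open>y - t\<close> for \<open>t\<close>; periodicity moves the interval \<open>[y - \<pi>, y + \<pi>]\<close> back to \<open>[-\<pi>, \<pi>]\<close>.
\<close>

lemma convolution_norm_le:
  fixes g f :: "real \<Rightarrow> complex"
  assumes g: "g \<in> borel_measurable lebesgue" "periodic_2pi g"
    and f: "f \<in> borel_measurable lebesgue" "periodic_2pi f"
  shows "ennreal (cmod (LINT t:{-pi..pi}|lebesgue. g (y - t) * f t))
    \<le> (\<integral>\<^sup>+t\<in>{-pi..pi}. ennreal (cmod (g t)) * ennreal (cmod (f (y - t))) \<partial>lebesgue)"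
proof -
  let ?h = "\<lambda>t. indicat_real {-pi..pi} t *\<^sub>R (g (y - t) * f t)"
  have "ennreal (cmod (LINT t|lebesgue. ?h t)) \<le> (\<integral>\<^sup>+t. ennreal (cmod (?h t)) \<partial>lebesgue)"
  proof (cases "integrable lebesgue ?h")
    case True
    then show ?thesis by (rule integral_norm_bound_ennreal)
  qed (simp add: not_integrable_integral_eq)
  also have "\<dots> = (\<integral>\<^sup>+t\<in>{-pi..pi}. ennreal (cmod (g (y - t))) * ennreal (cmod (f t)) \<partial>lebesgue)"
    by (intro nn_integral_cong) (auto simp: indicator_def norm_mult ennreal_mult)
  also have "\<dots> = (\<integral>\<^sup>+t\<in>{-pi..pi}. ennreal (cmod (g t)) * ennreal (cmod (f (y - t))) \<partial>lebesgue)"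
    using g f by (intro periodic_convolution_nn_integral) (auto simp: periodic_2pi_def)
  finally show ?thesis by (simp add: set_lebesgue_integral_def)
qed

text \<open>
  The value at \<open>y\<close> is taken into account at exactly those \<open>x\<close> that lie in the open ball of radius \<open>\<lambda>(r)\<close> about \<open>y\<close>, so
  the superlevel set is a union of such balls.
\<close>

lemma open_Phi_star_superlevel: "open {x. Phi_star lam \<phi> x f > c}"
proof -
  have "{x. Phi_star lam \<phi> x f > c} = (\<Union>r\<in>{0<..<1}. \<Union>y\<in>{y. c < ennreal (cmod (LINT t:{-pi..pi}|lebesgue. \<phi> r (y - t) * f t))}. ball y (lam r))"
    by (rule set_eqI) (simp add: Phi_star_def less_SUP_iff dist_real_def abs_minus_commute, blast)
  then show ?thesis by (auto intro!: open_UN)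
qed

text \<open>
  The bound for a single kernel depends on \<open>r\<close> only through the integral of the majorant and the quantity
  whose supremum is \<open>Pi_tilde\<close>, so it is uniform in \<open>r\<close>.
\<close>

lemma Phi_star_le_HL_maximal:
  fixes \<phi> :: "real \<Rightarrow> real \<Rightarrow> complex"
  assumes \<phi>: "\<And>r. r \<in> {0<..<1} \<Longrightarrow> \<phi> r \<in> Linf_circle"
    and c: "(SUP r\<in>{0<..<1}. \<integral>\<^sup>+ x\<in>{-pi..pi}. majorant (\<phi> r) x \<partial>lebesgue) < top"
    and p: "1 \<le> p" and K: "Pi_tilde p lam \<phi> < top"
  obtains C where "0 < C" "\<And>f x. f \<in> borel_measurable lebesgue \<Longrightarrow> periodic_2pi f \<Longrightarrow>
    Phi_star lam \<phi> x f \<le> ennreal C * ennreal_power (HL_maximal (\<lambda>u. cmod (f u) powr p) x) (1 / p)"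
proof -
  obtain c' where c': "0 \<le> c'" "(SUP r\<in>{0<..<1}. \<integral>\<^sup>+ x\<in>{-pi..pi}. majorant (\<phi> r) x \<partial>lebesgue) = ennreal c'"
    using c by (cases "SUP r\<in>{0<..<1}. \<integral>\<^sup>+ x\<in>{-pi..pi}. majorant (\<phi> r) x \<partial>lebesgue") auto
  obtain k where k: "0 \<le> k" "Pi_tilde p lam \<phi> = ennreal k" using K by (cases "Pi_tilde p lam \<phi>") auto
  \<comment> \<open>The summand \<open>1\<close> makes \<open>C\<close> positive.\<close>
  define C where "C = 20 * c' + 12 * k powr (1 / p) / (1 - 2 powr (- 1 / p)) + 1"
  have q: "2 powr (- 1 / p) < (1::real)" using p by (intro powr_less_one) auto
  have C: "0 < C" using c'(1) q unfolding C_def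
    by (intro add_nonneg_pos add_nonneg_nonneg divide_nonneg_pos mult_nonneg_nonneg) auto
  show thesis
  proof (rule that[OF C])
    fix f :: "real \<Rightarrow> complex" and x :: real
    assume f: "f \<in> borel_measurable lebesgue" "periodic_2pi f"
    let ?M = "HL_maximal (\<lambda>u. cmod (f u) powr p) x"
    show "Phi_star lam \<phi> x f \<le> ennreal C * ennreal_power ?M (1 / p)"
    proof (cases ?M)
      case top
      with C p show ?thesis by (simp add: ennreal_power_def ennreal_mult_top)
    next
      case (real m)
      have pw: "ennreal_power ?M (1 / p) = ennreal (m powr (1 / p))"
        using real p by (simp add: ennreal_power_def)
      show ?thesis
        unfolding Phi_star_def
      proof (intro SUP_least)
        fix r y :: real
        assume r: "r \<in> {0<..<1}" and y: "y \<in> {y. \<bar>x - y\<bar> < lam r}"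
        have g: "\<phi> r \<in> borel_measurable lebesgue" "periodic_2pi (\<phi> r)" "Linf_norm (\<phi> r) < top"
          using \<phi>[OF r] by (auto simp: Linf_circle_def)
        have c1: "(\<integral>\<^sup>+ x\<in>{-pi..pi}. majorant (\<phi> r) x \<partial>lebesgue) \<le> ennreal c'"
          unfolding c'(2)[symmetric] using r by (rule SUP_upper)
        have k1: "ennreal (lam r) * Linf_norm (\<phi> r) * ennreal_power (weighted_sup (\<phi> r)) (p - 1) \<le> ennreal k"
          unfolding k(2)[symmetric] Pi_tilde_def using r by (rule SUP_upper)
        have "ennreal (cmod (LINT t:{-pi..pi}|lebesgue. \<phi> r (y - t) * f t))
          \<le> (\<integral>\<^sup>+t\<in>{-pi..pi}. ennreal (cmod (\<phi> r t)) * ennreal (cmod (f (y - t))) \<partial>lebesgue)"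
          by (intro convolution_norm_le g f)
        also have "\<dots> \<le> ennreal ((20 * c' + 12 * k powr (1 / p) / (1 - 2 powr (- 1 / p))) * m powr (1 / p))"
          using f y real by (intro kernel_integral_le_HL_maximal[OF g(1,3) c'(1) c1 k(1) k1 _ _ p]) auto
        also have "\<dots> \<le> ennreal (C * m powr (1 / p))"
          by (intro ennreal_leI mult_right_mono) (auto simp: C_def)
        finally show "ennreal (cmod (LINT t:{-pi..pi}|lebesgue. \<phi> r (y - t) * f t)) \<le> ennreal C * ennreal_power ?M (1 / p)"
          using C by (simp add: pw ennreal_mult)
      qed
    qed
  qed
qed

lemma Lp_norm_powr_eq_nn_integral:
  assumes "f \<in> Lp_circle p" "1 \<le> p"
  shows "(\<integral>\<^sup>+t\<in>{-pi..pi}. ennreal (cmod (f t) powr p) \<partial>lebesgue) = ennreal (Lp_norm p f powr p)"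
proof -
  have int: "set_integrable lebesgue {-pi..pi} (\<lambda>t. cmod (f t) powr p)"
    using assms(1) by (simp add: Lp_circle_def)
  have "(\<integral>\<^sup>+t\<in>{-pi..pi}. ennreal (cmod (f t) powr p) \<partial>lebesgue)
    = (\<integral>\<^sup>+t. ennreal (indicator {-pi..pi} t *\<^sub>R cmod (f t) powr p) \<partial>lebesgue)"
    by (intro nn_integral_cong) (auto simp: indicator_def)
  also have "\<dots> = ennreal (LINT t:{-pi..pi}|lebesgue. cmod (f t) powr p)"
    using int unfolding set_integrable_def set_lebesgue_integral_def
    by (intro nn_integral_eq_integral) auto
  also have "(LINT t:{-pi..pi}|lebesgue. cmod (f t) powr p) = Lp_norm p f powr p"
  proof -
    have "0 \<le> (LINT t:{-pi..pi}|lebesgue. cmod (f t) powr p)"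
      unfolding set_lebesgue_integral_def by (intro integral_nonneg_AE) auto
    then show ?thesis using assms(2) by (simp add: Lp_norm_def powr_powr)
  qed
  finally show ?thesis .
qed

theorem theorem1p4:
  fixes \<phi> :: "real \<Rightarrow> real \<Rightarrow> complex" and lam :: "real \<Rightarrow> real" and p :: real
  assumes "approximate_identity \<phi>"
    and "1 \<le> p"
    and "\<And>r. r \<in> {0<..<1} \<Longrightarrow> 0 < lam r"
    and "(lam \<longlongrightarrow> 0) (at_left 1)"
    and "Pi_tilde p lam \<phi> < top"
  shows "(\<exists>C::real. 0 < C \<and>
            (\<forall>f\<in>Lp_circle p. \<forall>x.
               Phi_star lam \<phi> x f
                 \<le> ennreal C * ennreal_power (HL_maximal (\<lambda>u. cmod (f u) powr p) x) (1 / p))) \<and>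
         (\<exists>C'::real. 0 < C' \<and>
            (\<forall>f\<in>Lp_circle p. \<forall>t>0.
               {x\<in>{-pi..pi}. Phi_star lam \<phi> x f > ennreal t} \<in> sets lebesgue \<and>
               emeasure lebesgue {x\<in>{-pi..pi}. Phi_star lam \<phi> x f > ennreal t}
                 \<le> ennreal (C' / t powr p * Lp_norm p f powr p)))"
proof -
  note p = assms(2)
  obtain C where C: "0 < C" and bound: "\<And>f x. f \<in> borel_measurable lebesgue \<Longrightarrow> periodic_2pi f \<Longrightarrow>
    Phi_star lam \<phi> x f \<le> ennreal C * ennreal_power (HL_maximal (\<lambda>u. cmod (f u) powr p) x) (1 / p)"
    using Phi_star_le_HL_maximal[OF _ _ p assms(5)] assms(1) unfolding approximate_identity_def by blast
  have weak: "{x\<in>{-pi..pi}. Phi_star lam \<phi> x f > ennreal t} \<in> sets lebesgue \<and>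
      emeasure lebesgue {x\<in>{-pi..pi}. Phi_star lam \<phi> x f > ennreal t}
        \<le> ennreal (10 * C powr p / t powr p * Lp_norm p f powr p)"
    if f: "f \<in> Lp_circle p" and t: "0 < t" for f t
  proof -
    have fm: "f \<in> borel_measurable lebesgue" "periodic_2pi f" using f by (auto simp: Lp_circle_def)
    let ?E = "{x\<in>{-pi..pi}. Phi_star lam \<phi> x f > ennreal t}"
    have "?E = {-pi..pi} \<inter> {x. Phi_star lam \<phi> x f > ennreal t}" by auto
    then have "?E \<in> sets borel" using open_Phi_star_superlevel by auto
    then have E: "?E \<in> sets lebesgue" by simp
    \<comment> \<open>The level at which the pointwise bound \<open>C s\<^bsup>1/p\<^esup>\<close> equals \<open>t\<close>.\<close>
    define s where "s = (t / C) powr p"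
    have s: "0 < s" using t C by (simp add: s_def)
    have "ennreal s < HL_maximal (\<lambda>u. cmod (f u) powr p) x" if "x \<in> ?E" for x
    proof (rule ccontr)
      assume "\<not> ?thesis"
      then obtain m where m: "HL_maximal (\<lambda>u. cmod (f u) powr p) x = ennreal m" "0 \<le> m" "m \<le> s"
        using s by (cases "HL_maximal (\<lambda>u. cmod (f u) powr p) x") (auto simp: not_less top_unique)
      have "m powr (1 / p) \<le> s powr (1 / p)" using m p by (intro powr_mono2) auto
      also have "\<dots> = t / C" using t C p by (simp add: s_def powr_powr)
      finally have "C * m powr (1 / p) \<le> t" using C by (simp add: field_simps)
      moreover have "Phi_star lam \<phi> x f \<le> ennreal (C * m powr (1 / p))"
        using bound[OF fm, of x] m p C by (simp add: ennreal_power_def ennreal_mult)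
      ultimately have "Phi_star lam \<phi> x f \<le> ennreal t" by (meson ennreal_leI order_trans)
      then show False using that by (simp add: not_le[symmetric])
    qed
    then have "emeasure lebesgue ?E \<le> ennreal (10 * (Lp_norm p f powr p) / s)"
      using fm s E Lp_norm_powr_eq_nn_integral[OF f p]
      by (intro HL_maximal_weak_type_periodic[where F="\<lambda>u. cmod (f u) powr p"]) (auto simp: periodic_2pi_def)
    also have "10 * (Lp_norm p f powr p) / s = 10 * C powr p / t powr p * Lp_norm p f powr p"
      using t C by (simp add: s_def powr_divide)
    finally show ?thesis using E by simp
  qed
  have "0 < 10 * C powr p" using C by simp
  with C bound weak show ?thesis unfolding Lp_circle_def by blast
qed

end
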